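(* Consider a Boolean control network $x(t+1)=Lu(t)x(t)$, $y(t)=Hx(t)$ ($t=0,1,\dots$) with states $x(t)\in\Delta_N$, inputs $u(t)\in\Delta_M$, outputs $y(t)\in\Delta_Q$, where $L\in\mathcal{L}_{N\times(NM)}$ and $H\in\mathcal{L}_{Q\times N}$. The Boolean control network fails to be reconstructible in the Fornasini–Valcher sense (defined in the context) if and only if its weighted pair graph has a cycle.
   Context: Notation. $\delta_n^i$ is the $i$-th column of the $n\times n$ identity matrix and $\Delta_n=\{\delta_n^1,\dots,\delta_n^n\}$. $\mathcal{L}_{n\times s}$ is the set of $n\times s$ matrices all of whose columns lie in $\Delta_n$ (logical matrices). $N,M,Q$ are positive integers (for a genuine Boolean network with $n$ state, $m$ input and $q$ output nodes, $N=2^n$, $M=2^m$, $Q=2^q$, but arbitrary positive integers are allowed). Products are semi-tensor products; concretely, for $u\in\Delta_M$, $x\in\Delta_N$, $Lux=L(u\otimes x)\in\Delta_N$ with $\otimes$ the Kronecker product, so $L\delta_M^j\delta_N^i$ is column $(j-1)N+i$ of $L$; $Hx$ is the usual matrix product. $(\Delta_M)^p$ is the set of words of length $p$ over $\Delta_M$ (for $p=0$ it contains only the empty word); $\mathbb{N}$ includes $0$. Trajectories. For $x_0\in\Delta_N$, $p\in\mathbb{N}$ and $U=u_0\dots u_{p-1}\in(\Delta_M)^p$, let $x_{i+1}=Lu_ix_i$ for $0\le i<p$ and $y_i=Hx_i$ for $0\le i\le p$. Put $L_{x_0}^p(U)=x_0x_1\dots x_p$, $(HL)_{x_0}^p(U)=y_0y_1\dots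 y_p$, and let $L_{x_0}^p(U)[i]=x_i$. Reconstructibility in the Fornasini–Valcher sense. There is $p\in\mathbb{N}$ such that for each input sequence $U\in(\Delta_M)^p$, $U$ and the corresponding output sequence uniquely determine the current state (regardless of the unknown initial state); that is, for every $U\in(\Delta_M)^p$ and all $x_0,\bar x_0\in\Delta_N$, $L_{x_0}^p(U)[p]\ne L_{\bar x_0}^p(U)[p]$ implies $(HL)_{x_0}^p(U)\ne(HL)_{\bar x_0}^p(U)$. Weighted pair graph. It is the weighted directed graph $\mathcal{G}=(\mathcal{V},\mathcal{E},\mathcal{W},2^{\Delta_M})$ with vertex set $\mathcal{V}=\{\{x,x'\}\mid x,x'\in\Delta_N,\ x\ne x',\ Hx=Hx'\}$ (unordered pairs). For $\{x_1,x_1'\},\{x_2,x_2'\}\in\mathcal{V}$, the pair $(\{x_1,x_1'\},\{x_2,x_2'\})$ is in the edge set $\mathcal{E}\subset\mathcal{V}\times\mathcal{V}$ iff there exists $u\in\Delta_M$ such that ($Lux_1=x_2$ and $Lux_1'=x_2'$) or ($Lux_1=x_2'$ and $Lux_1'=x_2$); the weight $\mathcal{W}(e)\subset\Delta_M$ of such an edge $e$ is the set of all such $u$. Cycle. A cycle is a sequence of vertices $v_0,v_1,\dots,v_k$ with $k\ge1$, $(v_i,v_{i+1})\in\mathcal{E}$ for all $0\le i\le k-1$, and $v_0=v_k$. In particular, a self-loop (an edge from a vertex to itself) is a cycle. *)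

theory Defs
  imports "Jordan_Normal_Form.Matrix" "Graph_Theory.Pair_Digraph" Complex_Main
begin

definition Delta :: "nat \<Rightarrow> real vec set" where
  "Delta n = set (cols (1\<^sub>m n))"

definition logical_mats :: "nat \<Rightarrow> nat \<Rightarrow> real mat set" where
  "logical_mats n s = {A \<in> carrier_mat n s. set (cols A) \<subseteq> Delta n}"

text \<open>Kronecker product of column vectors, with the index of the second factor running fastest.\<close>

definition kron_vec :: "real vec \<Rightarrow> real vec \<Rightarrow> real vec" where
  "kron_vec u x = vec (dim_vec u * dim_vec x) (\<lambda>k. u $ (k div dim_vec x) * x $ (k mod dim_vec x))"

text \<open>The semi-tensor product \<open>L u x\<close>.\<close>

definition bcn_step :: "real mat \<Rightarrow> real vec \<Rightarrow> real vec \<Rightarrow> real vec" where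
  "bcn_step L u x = L *\<^sub>v kron_vec u x"

text \<open>Columns are numbered from 0 here, hence \<open>j * N + i\<close> in place of \<open>(j - 1) N + i\<close>.\<close>

lemma bcn_step_unit_vec:
  assumes L: "L \<in> carrier_mat N (N * M)" and j: "j < M" and i: "i < N"
  shows "bcn_step L (unit_vec M j) (unit_vec N i) = col L (j * N + i)"
proof -
  have lt: "j * N + i < N * M"
  proof -
    have "j * N + i < Suc j * N" using i by simp
    also have "\<dots> \<le> M * N" using j by (intro mult_right_mono) auto
    finally show ?thesis by (simp add: mult.commute)
  qed
  have "kron_vec (unit_vec M j) (unit_vec N i) = unit_vec (N * M) (j * N + i)"
  proof (rule eq_vecI)
    fix k assume "k < dim_vec (unit_vec (N * M) (j * N + i) :: real vec)"
    then have k: "k < M * N" by (simp add: mult.commute)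
    then have "k div N < M" "k mod N < N" using i by (auto simp: less_mult_imp_div_less)
    moreover have "k = j * N + i \<longleftrightarrow> k div N = j \<and> k mod N = i"
      using i by auto
    ultimately show "kron_vec (unit_vec M j) (unit_vec N i) $ k = unit_vec (N * M) (j * N + i) $ k"
      using k lt i j by (auto simp: kron_vec_def unit_vec_def mult.commute)
  qed (simp add: kron_vec_def mult.commute)
  moreover have "L *\<^sub>v unit_vec (N * M) (j * N + i) = col L (j * N + i)"
  proof (rule eq_vecI)
    fix r assume "r < dim_vec (col L (j * N + i))"
    then show "(L *\<^sub>v unit_vec (N * M) (j * N + i)) $ r = col L (j * N + i) $ r"
      using L lt by auto
  qed simp
  ultimately show ?thesis by (simp add: bcn_step_def)
qed

definition words :: "nat \<Rightarrow> 'a set \<Rightarrow> 'a list set" where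
  "words p A = {U. length U = p \<and> set U \<subseteq> A}"

text \<open>For a word of length \<open>p\<close> these lists have \<open>p + 1\<close> entries, numbered from 0 to \<open>p\<close>.\<close>

fun state_traj :: "real mat \<Rightarrow> real vec \<Rightarrow> real vec list \<Rightarrow> real vec list" where
  "state_traj L x [] = [x]"
| "state_traj L x (u # U) = x # state_traj L (bcn_step L u x) U"

definition output_traj :: "real mat \<Rightarrow> real mat \<Rightarrow> real vec \<Rightarrow> real vec list \<Rightarrow> real vec list" where
  "output_traj H L x U = map (\<lambda>z. H *\<^sub>v z) (state_traj L x U)"

definition reconstructible_FV :: "nat \<Rightarrow> nat \<Rightarrow> real mat \<Rightarrow> real mat \<Rightarrow> bool" where
  "reconstructible_FV N M L H \<longleftrightarrow>
    (\<exists>p. \<forall>U \<in> words p (Delta M). \<forall>x \<in> Delta N. \<forall>x' \<in> Delta N.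
      state_traj L x U ! p \<noteq> state_traj L x' U ! p \<longrightarrow> output_traj H L x U \<noteq> output_traj H L x' U)"

text \<open>The field \<open>weight\<close> is meaningful only on arcs.\<close>

record ('v, 'w) weighted_digraph = "'v pair_pre_digraph" +
  weight :: "'v \<times> 'v \<Rightarrow> 'w"

definition pair_vertices :: "nat \<Rightarrow> real mat \<Rightarrow> real vec set set" where
  "pair_vertices N H = {{x, x'} | x x'. x \<in> Delta N \<and> x' \<in> Delta N \<and> x \<noteq> x' \<and> H *\<^sub>v x = H *\<^sub>v x'}"

text \<open>The input \<open>u\<close> takes one unordered pair to the other, for either matching of their
  elements. This does not depend on the enumerations \<open>x1, x1'\<close> and \<open>x2, x2'\<close>.\<close>

definition input_maps_pair :: "real mat \<Rightarrow> real vec \<Rightarrow> real vec set \<Rightarrow> real vec set \<Rightarrow> bool" where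
  "input_maps_pair L u v w \<longleftrightarrow>
    (\<exists>x1 x1' x2 x2'. v = {x1, x1'} \<and> w = {x2, x2'} \<and>
      (bcn_step L u x1 = x2 \<and> bcn_step L u x1' = x2' \<or>
       bcn_step L u x1 = x2' \<and> bcn_step L u x1' = x2))"

definition weighted_pair_graph ::
  "nat \<Rightarrow> nat \<Rightarrow> real mat \<Rightarrow> real mat \<Rightarrow> (real vec set, real vec set) weighted_digraph" where
  "weighted_pair_graph N M L H =
    \<lparr> pverts = pair_vertices N H,
      parcs = {(v, w). v \<in> pair_vertices N H \<and> w \<in> pair_vertices N H \<and>
                       (\<exists>u \<in> Delta M. input_maps_pair L u v w)},
      weight = (\<lambda>(v, w). {u \<in> Delta M. input_maps_pair L u v w}) \<rparr>"

text \<open>A closed walk with at least one arc. Unlike \<open>pre_digraph.cycle\<close> of \<open>Graph_Theory\<close>,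
  it may repeat vertices.\<close>

definition is_cycle :: "('v, 'z) pair_pre_digraph_scheme \<Rightarrow> nat \<Rightarrow> (nat \<Rightarrow> 'v) \<Rightarrow> bool" where
  "is_cycle G k v \<longleftrightarrow>
    k \<ge> 1 \<and> (\<forall>i \<le> k. v i \<in> pverts G) \<and> (\<forall>i < k. (v i, v (Suc i)) \<in> parcs G) \<and> v 0 = v k"

definition has_cycle :: "('v, 'z) pair_pre_digraph_scheme \<Rightarrow> bool" where
  "has_cycle G \<longleftrightarrow> (\<exists>k v. is_cycle G k v)"

end

theory Submission
  imports Defs
begin

text \<open>
  A word of length \<open>p\<close> fails to determine the current state exactly when it drives two initial
  states to different final states with equal outputs. Since the system is deterministic,
  trajectories that have met stay together; so if the two final states differ, the two states
  differ at every earlier time too. The two trajectories thus pass through a vertex of the pair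
  graph at each time, and they trace a walk with \<open>p\<close> arcs. Conversely, inputs read off from the
  arcs of a walk move its initial pair along the walk, because an arc is nothing but the image of
  a pair under one input (\<open>input_maps_pair_iff_image\<close>). Hence some
  word of length \<open>p\<close> fails iff some walk has \<open>p\<close> arcs (\<open>ambiguous_word_iff_walk\<close>).

  The network therefore fails to be reconstructible iff the pair graph has walks of every length.
  As the graph is finite, this holds iff it has a cycle: a cycle can be traversed forever, and a
  walk with at least as many arcs as there are vertices revisits some vertex
  (\<open>has_cycle_iff_arbitrarily_long_walks\<close>).
\<close>

definition is_walk :: "('v, 'z) pair_pre_digraph_scheme \<Rightarrow> nat \<Rightarrow> (nat \<Rightarrow> 'v) \<Rightarrow> bool" where
  "is_walk G p v \<longleftrightarrow> (\<forall>i \<le> p. v i \<in> pverts G) \<and> (\<forall>i < p. (v i, v (Suc i)) \<in> parcs G)"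

text \<open>Going round a cycle over and over gives walks of every length. Conversely, a walk whose number
  of arcs is the number of vertices has one position more than there are vertices, so two of its
  positions coincide and the part between them is a cycle.\<close>

lemma has_cycle_iff_arbitrarily_long_walks:
  assumes fin: "finite (pverts G)"
  shows "has_cycle G \<longleftrightarrow> (\<forall>p. \<exists>v. is_walk G p v)"
proof
  assume "has_cycle G"
  then obtain k v where k: "k \<ge> 1" and vert: "\<And>i. i \<le> k \<Longrightarrow> v i \<in> pverts G"
    and arc: "\<And>i. i < k \<Longrightarrow> (v i, v (Suc i)) \<in> parcs G" and closed: "v 0 = v k"
    by (auto simp: has_cycle_def is_cycle_def)
  have lt: "i mod k < k" for i
    using k by simp
  \<comment> \<open>When the index wraps around, closedness identifies the two ends \<open>v 0\<close> and \<open>v k\<close>.\<close>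
  have "v (Suc i mod k) = v (Suc (i mod k))" for i
    using closed by (simp add: mod_Suc)
  then have "is_walk G p (\<lambda>i. v (i mod k))" for p
    using arc[OF lt] vert[OF less_imp_le[OF lt]] by (simp add: is_walk_def)
  then show "\<forall>p. \<exists>v. is_walk G p v"
    by blast
next
  assume "\<forall>p. \<exists>v. is_walk G p v"
  then obtain v where v: "is_walk G (card (pverts G)) v"
    by blast
  let ?p = "card (pverts G)"
  have "card (v ` {..?p}) \<le> ?p"
    using v fin by (intro card_mono) (auto simp: is_walk_def)
  then have "\<not> inj_on v {..?p}"
    by (auto dest: card_image)
  then obtain i j where "i < j" "j \<le> ?p" "v i = v j"
    by (metis atMost_iff inj_onI linorder_neqE_nat)
  then have "is_cycle G (j - i) (\<lambda>n. v (i + n))"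
    using v by (auto simp: is_cycle_def is_walk_def)
  then show "has_cycle G"
    by (auto simp: has_cycle_def)
qed

lemma Delta_eq: "Delta n = unit_vec n ` {..<n}"
  by (auto simp: Delta_def cols_def)

lemma bcn_step_in_Delta:
  assumes L: "L \<in> logical_mats N (N * M)" and u: "u \<in> Delta M" and x: "x \<in> Delta N"
  shows "bcn_step L u x \<in> Delta N"
proof -
  from u x obtain j i where ji: "u = unit_vec M j" "j < M" "x = unit_vec N i" "i < N"
    by (auto simp: Delta_eq)
  have "j * N + i < Suc j * N"
    using ji by simp
  also have "\<dots> \<le> M * N"
    using ji by (intro mult_right_mono) auto
  finally have "col L (j * N + i) \<in> set (cols L)"
    using L by (auto simp: logical_mats_def cols_def mult.commute)
  then show ?thesis
    using L ji by (auto simp: logical_mats_def bcn_step_unit_vec)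
qed

lemma finite_pair_vertices: "finite (pair_vertices N H)"
  by (rule finite_subset[of _ "Pow (Delta N)"]) (auto simp: pair_vertices_def Delta_def)

lemma pair_in_pair_vertices_iff:
  "{x, x'} \<in> pair_vertices N H \<longleftrightarrow>
    x \<in> Delta N \<and> x' \<in> Delta N \<and> x \<noteq> x' \<and> H *\<^sub>v x = H *\<^sub>v x'"
  by (auto simp: pair_vertices_def doubleton_eq_iff)

text \<open>The two matchings in the definition of an arc only express that the target is an unordered
  pair, so they collapse to a single equation between sets.\<close>

lemma input_maps_pair_iff_image:
  "input_maps_pair L u {x, x'} w \<longleftrightarrow> w = bcn_step L u ` {x, x'}"
  unfolding input_maps_pair_def by (auto simp: doubleton_eq_iff insert_commute)

lemma length_state_traj: "length (state_traj L x U) = Suc (length U)"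
  by (induction U arbitrary: x) auto

lemma state_traj_0: "state_traj L x U ! 0 = x"
  by (cases U) auto

lemma state_traj_Suc:
  "i < length U \<Longrightarrow> state_traj L x U ! Suc i = bcn_step L (U ! i) (state_traj L x U ! i)"
proof (induction U arbitrary: x i)
  case (Cons u U)
  then show ?case by (cases i) (auto simp: state_traj_0)
qed simp

lemma state_traj_in_Delta:
  assumes L: "L \<in> logical_mats N (N * M)" and U: "set U \<subseteq> Delta M" and x: "x \<in> Delta N"
    and i: "i \<le> length U"
  shows "state_traj L x U ! i \<in> Delta N"
  using i
proof (induction i)
  case (Suc i)
  then have "U ! i \<in> Delta M"
    using U by (auto simp: subset_iff)
  with Suc show ?case
    by (auto simp: state_traj_Suc intro!: bcn_step_in_Delta[OF L])
qed (simp add: state_traj_0 x)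

lemma state_traj_merge:
  assumes "state_traj L x U ! i = state_traj L x' U ! i" and "i \<le> j" and "j \<le> length U"
  shows "state_traj L x U ! j = state_traj L x' U ! j"
  using assms(2,3)
  by (induction j rule: dec_induct) (auto simp: assms(1) state_traj_Suc)

lemma output_traj_eq_iff:
  "output_traj H L x U = output_traj H L x' U \<longleftrightarrow>
    (\<forall>i \<le> length U. H *\<^sub>v (state_traj L x U ! i) = H *\<^sub>v (state_traj L x' U ! i))"
  by (auto simp: output_traj_def list_eq_iff_nth_eq length_state_traj less_Suc_eq_le)

definition ambiguous_word :: "nat \<Rightarrow> real mat \<Rightarrow> real mat \<Rightarrow> real vec list \<Rightarrow> bool" where
  "ambiguous_word N L H U \<longleftrightarrow>
    (\<exists>x \<in> Delta N. \<exists>x' \<in> Delta N.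
      state_traj L x U ! length U \<noteq> state_traj L x' U ! length U \<and>
      output_traj H L x U = output_traj H L x' U)"

lemma reconstructible_FV_iff_no_ambiguous_words:
  "reconstructible_FV N M L H \<longleftrightarrow> (\<exists>p. \<forall>U \<in> words p (Delta M). \<not> ambiguous_word N L H U)"
  unfolding reconstructible_FV_def ambiguous_word_def words_def by (rule ex_cong1) auto

text \<open>The final states differ, so by \<open>state_traj_merge\<close> the two trajectories are apart all along
  and the pairs of current states are vertices.\<close>

lemma ambiguous_word_imp_walk:
  assumes L: "L \<in> logical_mats N (N * M)" and U: "U \<in> words p (Delta M)"
    and amb: "ambiguous_word N L H U"
  shows "\<exists>v. is_walk (weighted_pair_graph N M L H) p v"
proof -
  from U have p: "length U = p" and inputs: "set U \<subseteq> Delta M"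
    by (auto simp: words_def)
  obtain x x' where x: "x \<in> Delta N" and x': "x' \<in> Delta N"
    and final: "state_traj L x U ! p \<noteq> state_traj L x' U ! p"
    and out: "output_traj H L x U = output_traj H L x' U"
    using amb p by (auto simp: ambiguous_word_def)
  define v where "v i = {state_traj L x U ! i, state_traj L x' U ! i}" for i
  have vert: "v i \<in> pair_vertices N H" if "i \<le> p" for i
  proof -
    have "state_traj L x U ! i \<noteq> state_traj L x' U ! i"
      using final that p state_traj_merge[of L x U i x' p] by auto
    moreover have "H *\<^sub>v (state_traj L x U ! i) = H *\<^sub>v (state_traj L x' U ! i)"
      using out that p by (simp add: output_traj_eq_iff)
    ultimately show ?thesis
      using state_traj_in_Delta[OF L inputs] x x' that p
      by (simp add: v_def pair_in_pair_vertices_iff)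
  qed
  have arc: "\<exists>u \<in> Delta M. input_maps_pair L u (v i) (v (Suc i))" if "i < p" for i
  proof
    show "U ! i \<in> Delta M"
      using inputs that p by auto
    show "input_maps_pair L (U ! i) (v i) (v (Suc i))"
      using that p by (simp add: v_def input_maps_pair_iff_image state_traj_Suc)
  qed
  have "is_walk (weighted_pair_graph N M L H) p v"
    using vert arc by (simp add: is_walk_def weighted_pair_graph_def)
  then show ?thesis
    by blast
qed

text \<open>Inputs chosen from the weights of the arcs steer the two states of the initial pair so that
  at each time the pair of current states is the vertex of the walk; being a vertex then says both
  that the outputs agree and that the states, in particular the final ones, differ.\<close>

lemma walk_imp_ambiguous_word:
  assumes walk: "is_walk (weighted_pair_graph N M L H) p v"
  shows "\<exists>U \<in> words p (Delta M). ambiguous_word N L H U"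
proof -
  have vert: "v i \<in> pair_vertices N H" if "i \<le> p" for i
    using walk that by (simp add: is_walk_def weighted_pair_graph_def)
  have "\<forall>i. \<exists>u. i < p \<longrightarrow> u \<in> Delta M \<and> input_maps_pair L u (v i) (v (Suc i))"
    using walk by (auto simp: is_walk_def weighted_pair_graph_def)
  then obtain u where u: "\<And>i. i < p \<Longrightarrow> u i \<in> Delta M"
    and arc: "\<And>i. i < p \<Longrightarrow> input_maps_pair L (u i) (v i) (v (Suc i))"
    by metis
  define U where "U = map u [0..<p]"
  have p: "length U = p"
    by (simp add: U_def)
  obtain x x' where start: "v 0 = {x, x'}"
    using vert[of 0] by (auto simp: pair_vertices_def)
  have states: "v i = {state_traj L x U ! i, state_traj L x' U ! i}" if "i \<le> p" for i
    using that
  proof (induction i)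
    case 0
    show ?case by (simp add: state_traj_0 start)
  next
    case (Suc i)
    then have "v (Suc i) = bcn_step L (u i) ` {state_traj L x U ! i, state_traj L x' U ! i}"
      using arc[of i] by (simp add: input_maps_pair_iff_image)
    then show ?case
      using Suc.prems p by (simp add: state_traj_Suc U_def)
  qed
  have apart: "state_traj L x U ! i \<noteq> state_traj L x' U ! i \<and>
      H *\<^sub>v (state_traj L x U ! i) = H *\<^sub>v (state_traj L x' U ! i)" if "i \<le> p" for i
    using vert[OF that] states[OF that] by (simp add: pair_in_pair_vertices_iff)
  have "x \<in> Delta N" "x' \<in> Delta N"
    using vert[of 0] start by (simp_all add: pair_in_pair_vertices_iff)
  then have "ambiguous_word N L H U"
    using apart p by (auto simp: ambiguous_word_def output_traj_eq_iff)
  moreover have "U \<in> words p (Delta M)"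
    using u by (auto simp: words_def U_def)
  ultimately show ?thesis
    by blast
qed

lemma ambiguous_word_iff_walk:
  assumes "L \<in> logical_mats N (N * M)"
  shows "(\<exists>U \<in> words p (Delta M). ambiguous_word N L H U) \<longleftrightarrow>
    (\<exists>v. is_walk (weighted_pair_graph N M L H) p v)"
  using ambiguous_word_imp_walk[OF assms] walk_imp_ambiguous_word by blast

theorem theorem5p2:
  fixes N M Q :: nat and L H :: "real mat"
  assumes "N > 0" and "M > 0" and "Q > 0"
    and "L \<in> logical_mats N (N * M)"
    and "H \<in> logical_mats Q N"
  shows "\<not> reconstructible_FV N M L H \<longleftrightarrow> has_cycle (weighted_pair_graph N M L H)"
proof -
  have "\<not> reconstructible_FV N M L H \<longleftrightarrow>
      (\<forall>p. \<exists>U \<in> words p (Delta M). ambiguous_word N L H U)"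
    by (simp add: reconstructible_FV_iff_no_ambiguous_words)
  also have "\<dots> \<longleftrightarrow> (\<forall>p. \<exists>v. is_walk (weighted_pair_graph N M L H) p v)"
    using ambiguous_word_iff_walk[OF assms(4)] by simp
  also have "\<dots> \<longleftrightarrow> has_cycle (weighted_pair_graph N M L H)"
    by (subst has_cycle_iff_arbitrarily_long_walks)
      (simp_all add: weighted_pair_graph_def finite_pair_vertices)
  finally show ?thesis .
qed

end
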